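(* Let $n$ and $k$ be positive integers. If $G \in \varGamma(n;k)$, then $$\Delta(G) \leq \frac{n-k^2+1}{2},$$ where $\Delta(G)$ denotes the maximum degree of $G$.
   Context: All graphs are simple, finite and undirected. The circumference $c(G)$ of a graph $G$ is the number of vertices in a longest cycle of $G$. A graph is Hamiltonian if it contains a cycle through all of its vertices. For positive integers $n$ and $k$ with $n \ge k$, $\varGamma(n;k)$ denotes the set of all graphs $G$ of order $n$ such that $c(G)=n-k$ and every induced subgraph of $G$ with $n-k$ vertices is Hamiltonian. *)

theory Defs
  imports Complex_Main "Graph_Theory.Graph_Theory"
begin

text \<open>
  A simple finite undirected graph is a \<^locale>\<open>pair_graph\<close>: a finite vertex set together with
  a symmetric irreflexive relation on it, each edge \<open>{u, v}\<close> being the two arcs \<open>(u, v)\<close> and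
  \<open>(v, u)\<close>. The library's \<^const>\<open>pre_digraph.cycle\<close> also accepts the closed walk \<open>u, v, u\<close>, which
  is not a cycle of the undirected graph, hence the bound on the length.
\<close>

definition graph_cycle :: "'a pair_pre_digraph \<Rightarrow> ('a \<times> 'a) list \<Rightarrow> bool" where
  "graph_cycle G p \<longleftrightarrow> pre_digraph.cycle (with_proj G) p \<and> 3 \<le> length p"

text \<open>Every vertex of a cycle is the tail of one of its arcs.\<close>

definition cycle_verts :: "('a \<times> 'a) list \<Rightarrow> 'a set" where
  "cycle_verts p = fst ` set p"

text \<open>For a graph without cycles this is \<open>Sup {} = 0\<close>.\<close>

definition circumference :: "'a pair_pre_digraph \<Rightarrow> nat" where
  "circumference G = Sup {card (cycle_verts p) | p. graph_cycle G p}"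

definition hamiltonian :: "'a pair_pre_digraph \<Rightarrow> bool" where
  "hamiltonian G \<longleftrightarrow> (\<exists>p. graph_cycle G p \<and> cycle_verts p = pverts G)"

text \<open>In a symmetric digraph the out-degree of a vertex is its degree in the undirected graph.\<close>

definition max_degree :: "'a pair_pre_digraph \<Rightarrow> nat" where
  "max_degree G = Max ((\<lambda>v. out_degree (with_proj G) v) ` pverts G)"

text \<open>
  Meant for \<open>k \<le> n\<close> only, so that the subtraction does not truncate.
\<close>

definition Gamma :: "nat \<Rightarrow> nat \<Rightarrow> 'a pair_pre_digraph set" where
  "Gamma n k = {G. pair_graph G \<and> card (pverts G) = n \<and> circumference G = n - k \<and>
     (\<forall>H :: 'a pair_pre_digraph.
        induced_subgraph (with_proj H) (with_proj G) \<and> card (pverts H) = n - k \<longrightarrow> hamiltonian H)}"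

end

theory Submission
  imports Defs
begin

text \<open>
  Let \<open>v\<close> have maximum degree. There is an induced path \<open>P\<close> with \<open>k\<close> vertices starting at \<open>v\<close>, and
  every vertex has degree at least \<open>k + 2\<close>. Label each vertex \<open>x\<close> of a Hamiltonian cycle of \<open>G - P\<close>
  with the set \<open>L x\<close> of positions on \<open>P\<close> of its neighbours. If \<open>x \<noteq> y\<close>, \<open>a \<in> L x\<close> and \<open>b \<in> L y\<close>, then
  the distance from \<open>x\<close> to \<open>y\<close> along the cycle is at least \<open>2 + \<bar>a - b\<bar>\<close>, since otherwise a
  detour through \<open>P\<close> gives a cycle longer than \<open>n - k\<close>. Summing over consecutive labelled vertices,
  \<open>n - k\<close> is at least the sum of \<open>1 + \<bar>L x\<bar>\<close> over labelled \<open>x\<close>, hence at least the number of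
  neighbours of \<open>v\<close> off \<open>P\<close> plus the number of edges leaving \<open>P\<close>.
\<close>

section \<open>Cycles as vertex lists\<close>

text \<open>Listing each vertex once lets cycle surgery be done with \<open>rotate\<close>,
  \<open>take\<close> and \<open>drop\<close>; the appended head supplies the closing edge.\<close>

definition list_cycle :: "('a \<Rightarrow> 'a \<Rightarrow> bool) \<Rightarrow> 'a list \<Rightarrow> bool" where
  "list_cycle E xs \<longleftrightarrow> 3 \<le> length xs \<and> distinct xs \<and> successively E (xs @ [hd xs])"

lemma list_cycle_subset:
  assumes "list_cycle E xs" "\<And>u v. E u v \<Longrightarrow> u \<in> V"
  shows "set xs \<subseteq> V"
proof -
  have "successively E (xs @ [v]) \<Longrightarrow> set xs \<subseteq> V" for v
  proof (induction xs)
    case (Cons x xs)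
    then show ?case using assms(2) by (auto simp: successively_Cons)
  qed simp
  then show ?thesis using assms(1) by (auto simp: list_cycle_def)
qed

lemma list_cycle_rotate1:
  assumes "list_cycle E xs"
  shows "list_cycle E (rotate1 xs)"
proof -
  obtain x y zs where "xs = x # y # zs"
    using assms by (auto simp: list_cycle_def numeral_3_eq_3 Suc_le_length_iff)
  then show ?thesis
    using assms successively_append_iff[of E "y # zs @ [x]" "[y]"] by (auto simp: list_cycle_def)
qed

lemma list_cycle_rotate: "list_cycle E xs \<Longrightarrow> list_cycle E (rotate n xs)"
  by (induction n) (auto intro: list_cycle_rotate1)

lemma list_cycle_start_at:
  assumes "list_cycle E xs" "x \<in> set xs"
  obtains ys where "list_cycle E ys" "set ys = set xs" "hd ys = x"
proof -
  obtain n where n: "n < length xs" "xs ! n = x"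
    using assms(2) by (auto simp: in_set_conv_nth)
  then have "hd (rotate n xs) = x"
    by (subst hd_rotate_conv_nth) auto
  with that[of "rotate n xs"] list_cycle_rotate[OF assms(1)] show thesis
    by simp
qed

text \<open>Position \<open>length xs\<close> denotes the return to the head, so the replaced arc
  may end with the closing edge. The condition \<open>0 < i \<or> j < length xs\<close> keeps its
  two ends distinct, so with the nonempty \<open>q\<close> at least three vertices remain.\<close>

lemma list_cycle_replace_arc:
  assumes cyc: "list_cycle E xs"
    and ij: "i < j" "j \<le> length xs" "0 < i \<or> j < length xs"
    and q: "q \<noteq> []" "distinct q" "successively E q" "set q \<inter> set xs = {}"
    and ends: "E ((xs @ [hd xs]) ! i) (hd q)" "E (last q) ((xs @ [hd xs]) ! j)"
  shows "list_cycle E (take (Suc i) xs @ q @ drop j xs)"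
proof -
  define ys where "ys = xs @ [hd xs]"
  have ne: "xs \<noteq> []" and dist: "distinct xs" and suc: "successively E ys"
    using cyc by (auto simp: list_cycle_def ys_def)
  have len: "length ys = Suc (length xs)" by (simp add: ys_def)
  have s1: "successively E (take (Suc i) ys)" and s2: "successively E (drop j ys)"
    using suc append_take_drop_id[of "Suc i" ys] append_take_drop_id[of j ys]
    by (metis successively_append_iff)+
  have t1: "last (take (Suc i) ys) = ys ! i" "take (Suc i) ys \<noteq> []"
    using ij len by (auto simp: take_Suc_conv_app_nth)
  have t2: "hd (drop j ys) = ys ! j" "drop j ys \<noteq> []"
    using ij len by (auto simp: hd_drop_conv_nth)
  have "successively E (take (Suc i) ys @ q @ drop j ys)"
    using s1 s2 t1 t2 q ends unfolding ys_def[symmetric]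
    by (auto simp: successively_append_iff)
  moreover have "take (Suc i) ys @ q @ drop j ys
      = (take (Suc i) xs @ q @ drop j xs) @ [hd (take (Suc i) xs @ q @ drop j xs)]"
    using ij ne by (auto simp: ys_def hd_append)
  moreover have "3 \<le> length (take (Suc i) xs @ q @ drop j xs)"
  proof -
    have "1 \<le> length q" using q by (simp add: Suc_le_eq)
    moreover have "length (take (Suc i) xs @ q @ drop j xs) = Suc i + length q + (length xs - j)"
      using ij by simp
    ultimately show ?thesis using ij by linarith
  qed
  moreover have "distinct (take (Suc i) xs @ q @ drop j xs)"
    using dist q ij set_take_subset[of "Suc i" xs] set_drop_subset[of j xs]
      set_take_disj_set_drop_if_distinct[OF dist, of "Suc i" j]
    by (auto simp: disjoint_iff)
  ultimately show ?thesis by (simp add: list_cycle_def)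
qed

section \<open>Counting labels around a cycle\<close>

text \<open>
  Position \<open>N\<close> is position \<open>0\<close> again. Going once around, the terms \<open>a - b\<close> of the gaps telescope
  to \<open>Max - Min\<close> at each labelled position.
\<close>

lemma sum_labels_le_segment:
  fixes L :: "nat \<Rightarrow> nat set"
  assumes fin: "\<And>t. finite (L t)"
    and gap: "\<And>i j a b. i < j \<Longrightarrow> j \<le> N \<Longrightarrow> 0 < i \<or> j < N \<Longrightarrow> a \<in> L i \<Longrightarrow> b \<in> L j \<Longrightarrow> i + 2 + a \<le> j + b"
    and "i < j" "j \<le> N" "0 < i \<or> j < N" "a \<in> L i" "b \<in> L j"
  shows "(\<Sum>t\<in>{i<..<j}. if L t = {} then 0 else Suc (card (L t))) + i + 2 + a \<le> j + b"
  using assms(3-)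
proof (induction j arbitrary: b rule: less_induct)
  case (less j)
  let ?w = "\<lambda>t. if L t = {} then 0 else Suc (card (L t))"
  let ?M = "{t \<in> {i<..<j}. L t \<noteq> {}}"
  show ?case
  proof (cases "?M = {}")
    case True
    then have "(\<Sum>t\<in>{i<..<j}. ?w t) = 0" by auto
    then show ?thesis using gap[OF less.prems] by simp
  next
    case False
    \<comment> \<open>The last labelled position before \<open>j\<close> splits the segment: the
      induction hypothesis ends at its least label, and \<open>gap\<close> continues from its
      greatest.\<close>
    define m where "m = Max ?M"
    have "m \<in> ?M" unfolding m_def using False by (intro Max_in) auto
    then have m: "i < m" "m < j" "L m \<noteq> {}" by auto
    have top: "t \<le> m" if "t \<in> ?M" for t unfolding m_def using that by (intro Max_ge) auto
    have empty: "L t = {}" if "t \<in> {m<..<j}" for t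
      using that m(1) top[of t] by auto
    have split: "{i<..<j} = {i<..<m} \<union> {m} \<union> {m<..<j}" using m by auto
    have "(\<Sum>t\<in>{i<..<j}. ?w t) = (\<Sum>t\<in>{i<..<m}. ?w t) + ?w m + (\<Sum>t\<in>{m<..<j}. ?w t)"
      unfolding split by (subst sum.union_disjoint; force)+
    also have "(\<Sum>t\<in>{m<..<j}. ?w t) = 0" using empty by auto
    finally have sum: "(\<Sum>t\<in>{i<..<j}. ?w t) = (\<Sum>t\<in>{i<..<m}. ?w t) + Suc (card (L m))"
      using m by simp
    have mn: "Min (L m) \<in> L m" "Max (L m) \<in> L m" using fin m by auto
    have "(\<Sum>t\<in>{i<..<m}. ?w t) + i + 2 + a \<le> m + Min (L m)"
      using less.IH[OF m(2) m(1) _ _ _ mn(1)] m less.prems by auto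
    moreover have "m + 2 + Max (L m) \<le> j + b"
      using gap[OF m(2) _ _ mn(2)] m less.prems by auto
    \<comment> \<open>Passing \<open>m\<close> gains \<open>2 + Max (L m) - Min (L m)\<close>. This
      pays for \<open>Suc (card (L m))\<close>, since the labels lie between their minimum and
      maximum.\<close>
    moreover have "card (L m) \<le> card {Min (L m)..Max (L m)}"
      using fin by (intro card_mono) auto
    moreover have "Min (L m) \<le> Max (L m)" using fin mn by auto
    ultimately show ?thesis unfolding sum by simp
  qed
qed

text \<open>The labelled positions \<open>0\<close> and \<open>m\<close> cut the cycle into two
  arcs, each bounded by the segment estimate. A second labelled position is required because
  \<open>gap\<close> says nothing about the pair \<open>0\<close>, \<open>N\<close>.\<close>

lemma sum_labels_le_cyclic:
  fixes L :: "nat \<Rightarrow> nat set"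
  assumes fin: "\<And>t. finite (L t)"
    and gap: "\<And>i j a b. i < j \<Longrightarrow> j \<le> N \<Longrightarrow> 0 < i \<or> j < N \<Longrightarrow> a \<in> L i \<Longrightarrow> b \<in> L j \<Longrightarrow> i + 2 + a \<le> j + b"
    and L: "L N = L 0" "L 0 \<noteq> {}" "0 < m" "m < N" "L m \<noteq> {}"
  shows "(\<Sum>t<N. if L t = {} then 0 else Suc (card (L t))) \<le> N"
proof -
  let ?w = "\<lambda>t. if L t = {} then 0 else Suc (card (L t))"
  have in0: "Min (L 0) \<in> L 0" "Max (L 0) \<in> L 0" and inm: "Min (L m) \<in> L m" "Max (L m) \<in> L m"
    using fin L by auto
  have 1: "(\<Sum>t\<in>{0<..<m}. ?w t) + 0 + 2 + Max (L 0) \<le> m + Min (L m)"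
    using L in0 inm by (intro sum_labels_le_segment[OF fin gap]) auto
  have 2: "(\<Sum>t\<in>{m<..<N}. ?w t) + m + 2 + Max (L m) \<le> N + Min (L 0)"
    using L in0 inm by (intro sum_labels_le_segment[OF fin gap]) auto
  have card: "card (L t) \<le> card {Min (L t)..Max (L t)}" for t
    using fin by (intro card_mono) auto
  have le: "Min (L 0) \<le> Max (L 0)" "Min (L m) \<le> Max (L m)"
    using fin in0 inm by auto
  have "{..<N} = {0} \<union> {0<..<m} \<union> {m} \<union> {m<..<N}" using L by auto
  then have "(\<Sum>t<N. ?w t) = ?w 0 + (\<Sum>t\<in>{0<..<m}. ?w t) + ?w m + (\<Sum>t\<in>{m<..<N}. ?w t)"
    using L(3) by (simp only:) (subst sum.union_disjoint; force)+
  then show ?thesis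
    using 1 2 card[of 0] card[of m] le L by simp
qed

lemma sum_of_bool_nth:
  assumes "distinct xs"
  shows "(\<Sum>t<length xs. of_bool (P (xs ! t))) = card {x \<in> set xs. P x}"
proof -
  have "(\<Sum>t<length xs. of_bool (P (xs ! t))) = (\<Sum>x\<in>set xs. of_bool (P x) :: nat)"
    using assms by (intro sum.reindex_bij_betw bij_betw_nth) auto
  also have "\<dots> = card {x \<in> set xs. P x}"
    by (simp add: of_bool_def sum.If_cases Int_def)
  finally show ?thesis .
qed

section \<open>Induced paths\<close>

definition induced_path :: "('a \<Rightarrow> 'a \<Rightarrow> bool) \<Rightarrow> 'a list \<Rightarrow> bool" where
  "induced_path E ps \<longleftrightarrow> distinct ps \<and>
     (\<forall>i<length ps. \<forall>j<length ps. E (ps ! i) (ps ! j) \<longleftrightarrow> j = Suc i \<or> i = Suc j)"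

text \<open>The stretch between the two positions, reversed if \<open>b < a\<close>, has |a - b| + 1
  vertices. Only the signed bound a - b + 1 is recorded, as this is the form that telescopes around
  a cycle.\<close>

lemma induced_path_subpath:
  assumes ps: "induced_path E ps" and ab: "a < length ps" "b < length ps"
  obtains q where "q \<noteq> []" "distinct q" "successively E q" "set q \<subseteq> set ps"
    "hd q = ps ! a" "last q = ps ! b" "a + 1 \<le> b + length q"
proof (cases "a \<le> b")
  case True
  define q where "q = take (Suc b - a) (drop a ps)"
  have "length q = Suc b - a" using ab by (simp add: q_def)
  moreover have "q ! t = ps ! (a + t)" if "t < length q" for t
    using that ab by (simp add: q_def)
  moreover have "set q \<subseteq> set ps" 
    using set_take_subset[of _ "drop a ps"] set_drop_subset[of a ps] unfolding q_def by blast
  moreover have "distinct q" using ps by (simp add: q_def induced_path_def)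
  ultimately show thesis using that[of q] ps ab True
    by (force simp: successively_conv_nth hd_conv_nth last_conv_nth induced_path_def)
next
  case False
  define q where "q = rev (take (Suc a - b) (drop b ps))"
  have len: "length q = Suc a - b" using ab by (simp add: q_def)
  moreover have "q ! t = ps ! (a - t)" if "t < length q" for t
    using that ab by (simp add: q_def rev_nth)
  moreover have "set q \<subseteq> set ps" 
    using set_take_subset[of _ "drop b ps"] set_drop_subset[of b ps] unfolding q_def by auto
  moreover have "distinct q" using ps by (simp add: q_def induced_path_def)
  ultimately show thesis using that[of q] ps ab False
    by (force simp: successively_conv_nth hd_conv_nth last_conv_nth induced_path_def)
qed

section \<open>Detours and minimum degree\<close>

text \<open>Here \<open>N\<close> stands for n - k, and an induced subgraph is given by the deleted
  set \<open>D\<close>. Its Hamiltonian cycle is a cycle of \<open>E\<close> itself, so cycles of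
  different subgraphs can be compared with the one bound \<open>N\<close>.\<close>

locale gamma_graph =
  fixes V :: "'a set" and E :: "'a \<Rightarrow> 'a \<Rightarrow> bool" and N k :: nat
  assumes finite_V: "finite V"
    and card_V: "card V = N + k"
    and sym: "E u v \<Longrightarrow> E v u"
    and irrefl: "\<not> E u u"
    and E_in_V: "E u v \<Longrightarrow> v \<in> V"
    and cycle_length_le: "list_cycle E xs \<Longrightarrow> length xs \<le> N"
    and hamiltonian_minus: "D \<subseteq> V \<Longrightarrow> card D = k \<Longrightarrow> \<exists>xs. list_cycle E xs \<and> set xs = V - D"
begin

lemma finite_nbrs: "finite {x. E u x}"
  by (rule finite_subset[OF _ finite_V]) (auto dest: E_in_V)

lemma obtain_cycle:
  assumes "D \<subseteq> V" "card D = k" "x \<in> V - D"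
  obtains xs where "list_cycle E xs" "set xs = V - D" "hd xs = x" "length xs = N"
proof -
  obtain xs where xs: "list_cycle E xs" "set xs = V - D"
    using hamiltonian_minus[OF assms(1,2)] by auto
  obtain ys where ys: "list_cycle E ys" "set ys = set xs" "hd ys = x"
    using list_cycle_start_at[OF xs(1)] xs assms(3) by metis
  have "length ys = card (V - D)"
    using ys xs by (metis distinct_card list_cycle_def)
  also have "\<dots> = N"
    using assms card_V finite_V by (simp add: card_Diff_subset finite_subset)
  finally show thesis using that ys xs by simp
qed

lemma N_ge_3: "3 \<le> N"
proof -
  obtain D where D: "D \<subseteq> V" "card D = k"
    using obtain_subset_with_card_n[of k V] card_V by auto
  then obtain xs where "list_cycle E xs"
    using hamiltonian_minus by blast
  then show ?thesis
    using cycle_length_le[of xs] by (simp add: list_cycle_def)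
qed

text \<open>Rerouting trades the j - i - 1 inner vertices of an arc for those of \<open>q\<close>;
  as no cycle is longer than \<open>N\<close>, \<open>q\<close> cannot have more.\<close>

lemma detour_le:
  assumes cyc: "list_cycle E xs" "length xs = N"
    and ij: "i < j" "j \<le> N" "0 < i \<or> j < N"
    and q: "q \<noteq> []" "distinct q" "successively E q" "set q \<inter> set xs = {}"
    and ends: "E ((xs @ [hd xs]) ! i) (hd q)" "E (last q) ((xs @ [hd xs]) ! j)"
  shows "i + 1 + length q \<le> j"
proof -
  have "list_cycle E (take (Suc i) xs @ q @ drop j xs)"
    using assms by (intro list_cycle_replace_arc) auto
  then show ?thesis
    using cycle_length_le cyc(2) ij by fastforce
qed

text \<open>Delete \<open>k\<close> vertices other than \<open>u\<close>, taking as many neighbours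
  of \<open>u\<close> as possible. A Hamiltonian cycle of the rest still passes through
  \<open>u\<close> and uses two further neighbours.\<close>

lemma degree_ge:
  assumes "u \<in> V"
  shows "k + 2 \<le> card {x. E u x}"
proof (rule ccontr)
  assume "\<not> ?thesis"
  then have le: "card {x. E u x} \<le> Suc k" by simp
  obtain A where A: "A \<subseteq> {x. E u x}" "card A = min k (card {x. E u x})"
    using obtain_subset_with_card_n[of "min k (card {x. E u x})" "{x. E u x}"] by auto
  have "A \<subseteq> V - {u}" using A irrefl E_in_V by auto
  moreover have "k \<le> card (V - {u})" using card_V N_ge_3 assms finite_V by simp
  ultimately obtain D where D: "A \<subseteq> D" "D \<subseteq> V - {u}" "card D = k"
    using exists_subset_between[of A k "V - {u}"] A finite_V by auto
  have Du: "D \<subseteq> V" "u \<in> V - D" using D assms by auto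
  obtain xs where xs: "list_cycle E xs" "set xs = V - D" "hd xs = u" "length xs = N"
    using obtain_cycle[OF Du(1) D(3) Du(2)] .
  obtain y z zs where yz: "xs = u # y # z # zs"
    using xs by (auto simp: list_cycle_def numeral_3_eq_3 Suc_le_length_iff)
  \<comment> \<open>The neighbours of \<open>u\<close> on the cycle are its second and last
    vertices, distinct because the length is at least three.\<close>
  have "last (z # zs) \<in> set (z # zs)" by (intro last_in_set) simp
  then have "y \<noteq> last (z # zs)" "last (z # zs) \<in> set xs"
    using xs(1) yz by (auto simp: list_cycle_def simp del: last.simps)
  moreover have "E u y" "E u (last (z # zs))"
    using xs(1) yz successively_append_iff[of E "u # y # z # zs" "[u]"]
    by (auto simp: list_cycle_def intro: sym)
  moreover have "y \<in> set xs" using yz by simp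
  ultimately have "{y, last (z # zs)} \<subseteq> {x. E u x} - A" "card {y, last (z # zs)} = 2"
    using xs(2) D by auto
  then have "2 \<le> card ({x. E u x} - A)"
    using finite_nbrs by (metis card_mono finite_Diff)
  also have "\<dots> = card {x. E u x} - card A"
    using A finite_nbrs by (meson card_Diff_subset finite_subset)
  finally show False using A le by simp
qed

section \<open>Growing an induced path\<close>

text \<open>
  If no extension exists, delete the path up to its last vertex \<open>u\<close>. Every neighbour of \<open>u\<close> left is a neighbour
  of an earlier path vertex, so the first edge of a Hamiltonian cycle through \<open>u\<close> can be rerouted
  through the deleted path, giving a cycle that is too long.
\<close>

lemma induced_path_extend:
  assumes ps: "induced_path E ps" "set ps \<subseteq> V" "ps \<noteq> []" "length ps \<le> k"
  obtains y where "induced_path E (ps @ [y])" "y \<in> V"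
proof -
  define l where "l = length ps - 1"
  define u where "u = ps ! l"
  have l: "l < length ps" "length ps = Suc l" using ps(3) by (auto simp: l_def)
  have dist: "distinct ps" using ps by (simp add: induced_path_def)
  have u: "u \<in> V" using ps l by (auto simp: u_def)
  have pre: "set (take l ps) \<subseteq> V - {u}"
  proof -
    have "u \<notin> set (take l ps)"
      using dist l by (auto simp: u_def in_set_conv_nth nth_eq_iff_index_eq)
    then show ?thesis using ps(2) set_take_subset[of l ps] by auto
  qed
  have "card (set (take l ps)) = l" using dist l by (simp add: distinct_card)
  moreover have "k \<le> card (V - {u})" using card_V N_ge_3 u finite_V by simp
  ultimately obtain D where D: "set (take l ps) \<subseteq> D" "D \<subseteq> V - {u}" "card D = k"
    using exists_subset_between[of "set (take l ps)" k "V - {u}"] pre finite_V l ps(4) by auto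
  have Du: "D \<subseteq> V" "u \<in> V - D" using D u by auto
  obtain xs where xs: "list_cycle E xs" "set xs = V - D" "hd xs = u" "length xs = N"
    using obtain_cycle[OF Du(1) D(3) Du(2)] .
  \<comment> \<open>The successor of \<open>u\<close> on the cycle will extend the path; it remains
    to exclude edges from it to earlier path vertices.\<close>
  define y where "y = xs ! 1"
  have y: "y \<in> set xs" using xs(4) N_ge_3 by (simp add: y_def)
  have "E (xs ! 0) (xs ! 1)"
    using xs(1) successively_nth[of E "xs @ [hd xs]" 0]
    by (cases xs rule: remdups_adj.cases) (auto simp: list_cycle_def)
  moreover have xs0: "xs ! 0 = u" using xs(3,4) N_ge_3 by (metis hd_conv_nth list.size(3) not_numeral_le_zero)
  ultimately have Euy: "E u y" by (simp add: y_def)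
  have new: "y \<notin> set ps"
  proof
    assume "y \<in> set ps"
    then obtain i where i: "i < length ps" "y = ps ! i" by (auto simp: in_set_conv_nth)
    have "i \<noteq> l" using Euy irrefl i by (auto simp: u_def)
    then have "y \<in> set (take l ps)" using i l by (auto simp: in_set_conv_nth intro!: exI[of _ i])
    then show False using y xs(2) D(1) by auto
  qed
  have far: "\<not> E (ps ! i) y" if i: "i < l" for i
  proof
    assume Ey: "E (ps ! i) y"
    have ind: "induced_path E (take l ps)" using ps(1) by (auto simp: induced_path_def)
    \<comment> \<open>From \<open>u\<close> the detour steps back to position \<open>l - 1\<close>
      and follows the path down to \<open>i\<close>, which is adjacent to \<open>y\<close>. The
      single cycle edge from \<open>u\<close> to \<open>y\<close> leaves no room for it.\<close>
    obtain q where q: "q \<noteq> []" "distinct q" "successively E q" "set q \<subseteq> set (take l ps)"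
      "hd q = take l ps ! (l - 1)" "last q = take l ps ! i"
      using induced_path_subpath[OF ind, of "l - 1" i] i l by auto
    have "E u (hd q)" using ps(1) q i l by (auto simp: induced_path_def u_def)
    moreover have "E (last q) y" using q i Ey by simp
    moreover have "set q \<inter> set xs = {}" using q xs(2) D(1) by auto
    ultimately have "0 + 1 + length q \<le> 1"
      using xs q N_ge_3 xs0
      by (intro detour_le[of xs 0 1 q]) (auto simp: nth_append y_def simp del: nth_Cons_0)
    then show False using q by simp
  qed
  have "induced_path E (ps @ [y])"
    unfolding induced_path_def
  proof (intro conjI allI impI)
    show "distinct (ps @ [y])" using dist new by simp
    fix i j assume ij: "i < length (ps @ [y])" "j < length (ps @ [y])"
    have ends: "E (ps ! i) y \<longleftrightarrow> i = l" "E y (ps ! i) \<longleftrightarrow> i = l" if "i < length ps" for i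
      using that l far[of i] Euy sym by (auto simp: u_def less_Suc_eq)
    show "E ((ps @ [y]) ! i) ((ps @ [y]) ! j) \<longleftrightarrow> j = Suc i \<or> i = Suc j"
      using ij ps(1) ends[of i] ends[of j] irrefl l by (auto simp: nth_append induced_path_def)
  qed
  with that y xs(2) show thesis by auto
qed

lemma exists_induced_path:
  assumes "v \<in> V" "0 < k"
  obtains ps where "induced_path E ps" "set ps \<subseteq> V" "length ps = k" "hd ps = v"
proof -
  have "\<exists>ps. induced_path E ps \<and> set ps \<subseteq> V \<and> length ps = Suc n \<and> hd ps = v" if "n < k" for n
    using that
  proof (induction n)
    case 0
    then show ?case
      using assms irrefl by (intro exI[of _ "[v]"]) (auto simp: induced_path_def)
  next
    case (Suc n)
    then obtain ps where ps: "induced_path E ps" "set ps \<subseteq> V" "length ps = Suc n" "hd ps = v"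
      by auto
    then have "ps \<noteq> []" by auto
    with ps Suc.prems obtain y where "induced_path E (ps @ [y])" "y \<in> V"
      using induced_path_extend[of ps] by auto
    then show ?case
      using ps \<open>ps \<noteq> []\<close> by (intro exI[of _ "ps @ [y]"]) auto
  qed
  from this[of "k - 1"] assms(2) that show thesis by auto
qed

section \<open>Counting edges that leave the path\<close>

text \<open>The two \<open>of_bool\<close> terms account for the predecessor and the successor on
  the path, where they exist; inducedness rules out any other neighbour on it.\<close>

lemma nbrs_off_induced_path:
  assumes ps: "induced_path E ps" and i: "i < length ps"
  shows "card {x. E (ps ! i) x}
    \<le> card {x \<in> V - set ps. E (ps ! i) x} + of_bool (0 < i) + of_bool (Suc i < length ps)"
proof -
  let ?P = "(if 0 < i then {ps ! (i - 1)} else {}) \<union> (if Suc i < length ps then {ps ! Suc i} else {})"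
  have "{x. E (ps ! i) x} \<subseteq> {x \<in> V - set ps. E (ps ! i) x} \<union> ?P"
  proof
    fix x assume x: "x \<in> {x. E (ps ! i) x}"
    show "x \<in> {x \<in> V - set ps. E (ps ! i) x} \<union> ?P"
    proof (cases "x \<in> set ps")
      case True
      then obtain j where "j < length ps" "x = ps ! j" by (auto simp: in_set_conv_nth)
      then show ?thesis using x ps i by (auto simp: induced_path_def)
    next
      case False
      then show ?thesis using x E_in_V by auto
    qed
  qed
  then have "card {x. E (ps ! i) x} \<le> card ({x \<in> V - set ps. E (ps ! i) x} \<union> ?P)"
    using finite_V by (intro card_mono) auto
  also have "\<dots> \<le> card {x \<in> V - set ps. E (ps ! i) x} + card ?P"
    by (rule card_Un_le)
  also have "card ?P \<le> of_bool (0 < i) + of_bool (Suc i < length ps)"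
    by (rule order.trans[OF card_Un_le]) auto
  finally show ?thesis by simp
qed

text \<open>Double counting of pairs of a cycle vertex and a label gives the edges leaving the path.
  The extra 1 at each labelled vertex pays for counting the neighbours of the start a second
  time.\<close>

lemma edges_off_induced_path_le:
  assumes ps: "induced_path E ps" "set ps \<subseteq> V" "length ps = k" "0 < k"
  shows "card {x \<in> V - set ps. E (ps ! 0) x} + (\<Sum>i<k. card {x \<in> V - set ps. E (ps ! i) x}) \<le> N"
proof -
  have dist: "distinct ps" using ps by (simp add: induced_path_def)
  have D: "card (set ps) = k" using dist ps by (simp add: distinct_card)
  have v: "ps ! 0 \<in> V" using ps by auto
  \<comment> \<open>At most one neighbour of the start lies on the path. Two neighbours off it
    provide the two labelled positions that the cyclic estimate needs, one of them placed at
    position \<open>0\<close>.\<close>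
  have "2 \<le> card {x \<in> V - set ps. E (ps ! 0) x}"
    using degree_ge[OF v] nbrs_off_induced_path[OF ps(1), of 0] ps by (auto simp: of_bool_def split: if_splits)
  then obtain x y where xy: "x \<in> V - set ps" "y \<in> V - set ps" "E (ps ! 0) x" "E (ps ! 0) y" "x \<noteq> y"
    using card_le_Suc0_iff_eq[of "{x \<in> V - set ps. E (ps ! 0) x}"] finite_V by force
  obtain xs where xs: "list_cycle E xs" "set xs = V - set ps" "hd xs = x" "length xs = N"
    using obtain_cycle[OF ps(2) D xy(1)] .
  have dxs: "distinct xs" using xs by (simp add: list_cycle_def)
  have xs0: "xs ! 0 = x" using xs(3,4) N_ge_3 by (metis hd_conv_nth list.size(3) not_numeral_le_zero)
  obtain m where m: "m < N" "xs ! m = y" using xy(2) xs by (metis in_set_conv_nth)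
  have m0: "0 < m" using m xs0 xy(5) by (cases m) auto
  \<comment> \<open>Appending \<open>x\<close> makes position \<open>N\<close> a second copy of
    position \<open>0\<close>.\<close>
  define L where "L t = {i. i < k \<and> E (ps ! i) ((xs @ [x]) ! t)}" for t
  have fin: "finite (L t)" for t by (simp add: L_def)
  have gap: "i + 2 + a \<le> j + b"
    if ij: "i < j" "j \<le> N" "0 < i \<or> j < N" and ab: "a \<in> L i" "b \<in> L j" for i j a b
  proof -
    have ab': "a < length ps" "b < length ps" using ab ps by (auto simp: L_def)
    obtain q where q: "q \<noteq> []" "distinct q" "successively E q" "set q \<subseteq> set ps"
      "hd q = ps ! a" "last q = ps ! b" "a + 1 \<le> b + length q"
      using induced_path_subpath[OF ps(1) ab'] by metis
    \<comment> \<open>The detour leaves the cycle at \<open>i\<close>, follows the path from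
      \<open>a\<close> to \<open>b\<close> and returns at \<open>j\<close>; its length bound turns
      into the required gap.\<close>
    have "i + 1 + length q \<le> j"
      using q ij ab xs sym by (intro detour_le[OF xs(1,4)]) (auto simp: L_def)
    then show ?thesis using q by linarith
  qed
  have "(\<Sum>t<N. if L t = {} then 0 else Suc (card (L t))) \<le> N"
  proof (rule sum_labels_le_cyclic[OF fin gap])
    show "L N = L 0" using xs xs0 N_ge_3 by (auto simp: L_def nth_append)
    show "L 0 \<noteq> {}" "L m \<noteq> {}" using ps xs xs0 xy m N_ge_3 by (auto simp: L_def nth_append)
  qed (use m m0 in auto)
  \<comment> \<open>Of the extra 1 at each labelled position, only that at neighbours of the path's
    start is kept.\<close>
  moreover have "(\<Sum>t<N. of_bool (0 \<in> L t) + card (L t)) \<le> (\<Sum>t<N. if L t = {} then 0 else Suc (card (L t)))"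
    by (intro sum_mono) auto
  moreover have "(\<Sum>t<N. of_bool (0 \<in> L t)) = card {z \<in> V - set ps. E (ps ! 0) z}"
  proof -
    have "(\<Sum>t<N. of_bool (0 \<in> L t)) = (\<Sum>t<length xs. of_bool (E (ps ! 0) (xs ! t)) :: nat)"
      using xs ps by (intro sum.cong) (auto simp: L_def nth_append)
    then show ?thesis using sum_of_bool_nth[OF dxs, of "E (ps ! 0)"] xs(2) by simp
  qed
  moreover have "(\<Sum>t<N. card (L t)) = (\<Sum>i<k. card {z \<in> V - set ps. E (ps ! i) z})"
  proof -
    have "card (L t) = (\<Sum>i<k. of_bool (E (ps ! i) (xs ! t)))" if "t < N" for t
    proof -
      have "L t = {i \<in> {..<k}. E (ps ! i) (xs ! t)}" using that xs by (auto simp: L_def nth_append)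
      then show ?thesis by (simp add: of_bool_def sum.If_cases Int_def)
    qed
    then have "(\<Sum>t<N. card (L t)) = (\<Sum>t<N. \<Sum>i<k. of_bool (E (ps ! i) (xs ! t)))"
      by (intro sum.cong) auto
    also have "\<dots> = (\<Sum>i<k. \<Sum>t<length xs. of_bool (E (ps ! i) (xs ! t)))"
      using xs(4) by (subst sum.swap) simp
    also have "\<dots> = (\<Sum>i<k. card {z \<in> V - set ps. E (ps ! i) z})"
      using xs(2) by (simp add: sum_of_bool_nth[OF dxs])
    finally show ?thesis .
  qed
  ultimately show ?thesis by (simp add: sum.distrib)
qed

lemma degree_bound:
  assumes "v \<in> V" "0 < k"
  shows "2 * card {x. E v x} + k\<^sup>2 \<le> N + k + 1"
proof -
  \<comment> \<open>Starting the path at \<open>v\<close> puts \<open>v\<close> at position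
    \<open>0\<close>, the one counted twice.\<close>
  obtain ps where ps: "induced_path E ps" "set ps \<subseteq> V" "length ps = k" "hd ps = v"
    using exists_induced_path[OF assms] by metis
  have v: "ps ! 0 = v" using ps assms by (metis hd_conv_nth length_greater_0_conv)
  define A where "A i = card {x \<in> V - set ps. E (ps ! i) x}" for i
  have total: "A 0 + (\<Sum>i<k. A i) \<le> N"
    using edges_off_induced_path_le[OF ps(1-3) assms(2)] by (simp add: A_def)
  have off: "card {x. E (ps ! i) x} \<le> A i + of_bool (0 < i) + of_bool (Suc i < k)" if "i < k" for i
    using nbrs_off_induced_path[OF ps(1)] that ps(3) by (simp add: A_def)
  have A_ge: "k \<le> A i" "Suc i = k \<Longrightarrow> k + 1 \<le> A i" if "0 < i" "i < k" for i
  proof -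
    have "ps ! i \<in> V" using ps that by auto
    from degree_ge[OF this] off[OF that(2)] that
    show "k \<le> A i" "Suc i = k \<Longrightarrow> k + 1 \<le> A i" by (auto simp: of_bool_def split: if_splits)
  qed
  obtain l where l: "k = Suc l" using assms(2) by (cases k) auto
  show ?thesis
  \<comment> \<open>For k = 1 the path is \<open>v\<close> alone. Otherwise \<open>v\<close> loses
    one neighbour to the path, each of the k - 2 inner vertices sends at least \<open>k\<close>
    edges off it and the last vertex at least \<open>k + 1\<close>, so 2(d - 1) + (k - 2)k + k + 1
    \<le> N with d the degree of \<open>v\<close>.\<close>
  proof (cases l)
    case 0
    then show ?thesis using total off[of 0] v l by simp
  next
    case (Suc l')
    have "(\<Sum>i<l'. k) \<le> (\<Sum>i<l'. A (Suc i))"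
      using A_ge l Suc by (intro sum_mono) simp
    moreover have "(\<Sum>i<k. A i) = A 0 + ((\<Sum>i<l'. A (Suc i)) + A (Suc l'))"
      unfolding l Suc by (subst sum.lessThan_Suc_shift) simp
    moreover have "k + 1 \<le> A (Suc l')" using A_ge l Suc by simp
    moreover have "card {x. E v x} \<le> A 0 + 1" using off[of 0] v l Suc by simp
    ultimately show ?thesis using total l Suc by (simp add: power2_eq_square algebra_simps)
  qed
qed

end

section \<open>Translation between arc walks and vertex lists\<close>

lemma pawalk_verts_pcas: "pcas u p v \<Longrightarrow> pawalk_verts u p = map fst p @ [v]"
  by (induction p arbitrary: u) auto

lemma pcas_successively:
  "pcas u p v \<Longrightarrow> set p \<subseteq> R \<Longrightarrow> successively (\<lambda>x y. (x, y) \<in> R) (map fst p @ [v])"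
proof (induction p arbitrary: u)
  case (Cons e p)
  then show ?case by (cases p; cases e) auto
qed simp

lemma successively_pcas:
  assumes "successively (\<lambda>x y. (x, y) \<in> R) (xs @ [v])"
  shows "\<exists>p. map fst p = xs \<and> set p \<subseteq> R \<and> pcas (hd (xs @ [v])) p v"
  using assms
proof (induction xs)
  case (Cons x xs)
  then obtain p where p: "map fst p = xs" "set p \<subseteq> R" "pcas (hd (xs @ [v])) p v"
    by (auto simp: successively_Cons)
  then show ?case
    using Cons.prems by (intro exI[of _ "(x, hd (xs @ [v])) # p"]) (auto simp: successively_Cons)
qed simp

lemma graph_cycle_imp_list_cycle:
  assumes "graph_cycle G p"
  shows "list_cycle (\<lambda>x y. (x, y) \<in> parcs G) (map fst p)"
proof -
  obtain u where u: "set p \<subseteq> parcs G" "pcas u p u" "distinct (tl (pawalk_verts u p))" "3 \<le> length p"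
    using assms by (auto simp: graph_cycle_def pre_digraph.cycle_def pre_digraph.awalk_def
        cas_with_proj_eq awalk_verts_with_proj_eq)
  obtain e es where p: "p = e # es" using u(4) by (cases p) auto
  have "fst e = u" using u(2) p by simp
  \<comment> \<open>The walk visits \<open>map fst p @ [u]\<close>; dropping its first vertex only
    rotates \<open>map fst p\<close>, so distinctness carries over.\<close>
  then have "distinct (map fst p)" "hd (map fst p) = u"
    using u(3) pawalk_verts_pcas[OF u(2)] p by auto
  then show ?thesis
    using pcas_successively[OF u(2,1)] u(4) by (simp add: list_cycle_def)
qed

lemma list_cycle_imp_graph_cycle:
  assumes "list_cycle (\<lambda>x y. (x, y) \<in> parcs G) xs" "set xs \<subseteq> pverts G"
  obtains p where "graph_cycle G p" "map fst p = xs"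
proof -
  obtain x ys where xs: "xs = x # ys" using assms(1) by (cases xs) (auto simp: list_cycle_def)
  obtain p where p: "map fst p = xs" "set p \<subseteq> parcs G" "pcas x p x"
  proof -
    have "successively (\<lambda>x y. (x, y) \<in> parcs G) (xs @ [x])"
      using assms(1) by (simp add: list_cycle_def xs)
    from successively_pcas[OF this] that show thesis by (metis xs append_Cons list.sel(1))
  qed
  have "distinct (tl (pawalk_verts x p))"
    using pawalk_verts_pcas[OF p(3)] p(1) assms(1) by (auto simp: xs list_cycle_def)
  moreover have "length p = length xs" using p(1) by auto
  ultimately have "graph_cycle G p"
    using p assms by (auto simp: graph_cycle_def pre_digraph.cycle_def pre_digraph.awalk_def
        cas_with_proj_eq awalk_verts_with_proj_eq list_cycle_def xs intro!: exI[of _ x])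
  with that p show thesis by blast
qed

lemma cycle_verts_conv: "cycle_verts p = set (map fst p)"
  by (simp add: cycle_verts_def)

lemma list_cycle_length_le_circumference:
  assumes "pair_fin_digraph G" "list_cycle (\<lambda>x y. (x, y) \<in> parcs G) xs"
  shows "length xs \<le> circumference G"
proof -
  interpret pair_fin_digraph G by fact
  have subset: "set ys \<subseteq> pverts G" if "list_cycle (\<lambda>x y. (x, y) \<in> parcs G) ys" for ys
    using that by (rule list_cycle_subset) (rule in_arcsD1)
  obtain p where p: "graph_cycle G p" "map fst p = xs"
    using list_cycle_imp_graph_cycle[OF assms(2) subset[OF assms(2)]] .
  have "length xs = card (cycle_verts p)"
    using assms(2) p(2) by (simp add: cycle_verts_conv list_cycle_def distinct_card)
  moreover have "cycle_verts q \<subseteq> pverts G" if "graph_cycle G q" for q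
    using subset[OF graph_cycle_imp_list_cycle[OF that]] by (simp add: cycle_verts_conv)
  \<comment> \<open>On \<open>nat\<close>, \<open>Sup\<close> is known to be an upper bound only for
    bounded sets; here the finite vertex set bounds all cycle sizes.\<close>
  then have "bdd_above {card (cycle_verts p) | p. graph_cycle G p}"
    using pair_finite_verts by (intro bdd_aboveI[of _ "card (pverts G)"]) (auto intro!: card_mono)
  ultimately show ?thesis
    unfolding circumference_def using p(1) by (auto intro: cSup_upper)
qed

lemma Gamma_imp_gamma_graph:
  assumes G: "G \<in> Gamma n k" and k: "k \<le> n"
  shows "gamma_graph (pverts G) (\<lambda>x y. (x, y) \<in> parcs G) (n - k) k"
proof -
  interpret pair_graph G using G by (simp add: Gamma_def)
  show ?thesis
  proof
    show "finite (pverts G)" by (rule pair_finite_verts)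
    show "card (pverts G) = n - k + k" using G k by (simp add: Gamma_def)
    show "(v, u) \<in> parcs G" if "(u, v) \<in> parcs G" for u v using that by (rule arcs_symmetric)
    show "(u, u) \<notin> parcs G" for u using no_loops' by blast
    show "v \<in> pverts G" if "(u, v) \<in> parcs G" for u v using that by (rule in_arcsD2)
    show "length xs \<le> n - k" if "list_cycle (\<lambda>x y. (x, y) \<in> parcs G) xs" for xs
      using list_cycle_length_le_circumference[OF pair_fin_digraph that] G by (simp add: Gamma_def)
    show "\<exists>xs. list_cycle (\<lambda>x y. (x, y) \<in> parcs G) xs \<and> set xs = pverts G - D"
      if D: "D \<subseteq> pverts G" "card D = k" for D
    proof -
      \<comment> \<open>Deleting \<open>D\<close> together with all incident arcs gives the induced
        subgraph to which the hypothesis applies.\<close>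
      define H where "H = \<lparr> pverts = pverts G - D, parcs = {e \<in> parcs G. fst e \<notin> D \<and> snd e \<notin> D} \<rparr>"
      have "pair_wf_digraph H"
        by unfold_locales (auto simp: H_def arc_fst_in_verts arc_snd_in_verts)
      then have "induced_subgraph (with_proj H) (with_proj G)"
        using wf_digraph_wp_iff[of H] wf_digraph_axioms
        by (auto simp: induced_subgraph_def subgraph_def compatible_def H_def arc_fst_in_verts arc_snd_in_verts in_arcsD1 in_arcsD2)
      moreover have "card (pverts H) = n - k"
        using D G pair_finite_verts by (simp add: H_def Gamma_def card_Diff_subset finite_subset)
      ultimately have "hamiltonian H" using G by (simp add: Gamma_def)
      then obtain p where p: "graph_cycle H p" "cycle_verts p = pverts H" by (auto simp: hamiltonian_def)
      have "list_cycle (\<lambda>x y. (x, y) \<in> parcs G) (map fst p)"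
        using graph_cycle_imp_list_cycle[OF p(1)]
        unfolding list_cycle_def by (auto simp: H_def elim!: successively_mono)
      then show ?thesis using p(2) by (intro exI[of _ "map fst p"]) (simp add: cycle_verts_conv H_def)
    qed
  qed
qed

theorem theorem1p2:
  fixes n k :: nat and G :: "'a pair_pre_digraph"
  assumes "0 < n" and "0 < k" and "k \<le> n"
    and "G \<in> Gamma n k"
  shows "real (max_degree G) \<le> (real n - (real k)\<^sup>2 + 1) / 2"
proof -
  interpret gamma_graph "pverts G" "\<lambda>x y. (x, y) \<in> parcs G" "n - k" k
    using Gamma_imp_gamma_graph assms by blast
  have "pverts G \<noteq> {}" using card_V assms by auto
  then have "max_degree G \<in> (\<lambda>v. out_degree (with_proj G) v) ` pverts G"
    unfolding max_degree_def using finite_V by (intro Max_in) auto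
  then obtain v where v: "v \<in> pverts G" "max_degree G = out_degree (with_proj G) v" by auto
  have "out_arcs (with_proj G) v = Pair v ` {x. (v, x) \<in> parcs G}"
    by (auto simp: out_arcs_def)
  then have "max_degree G = card {x. (v, x) \<in> parcs G}"
    using v(2) by (simp add: out_degree_def card_image inj_on_def)
  then have "2 * max_degree G + k\<^sup>2 \<le> n + 1"
    using degree_bound[OF v(1) assms(2)] assms(3) by simp
  \<comment> \<open>The estimate is kept additive on \<open>nat\<close> and cast only now, so no
    subtraction truncates when \<open>k\<^sup>2\<close> exceeds \<open>n\<close>.\<close>
  then have "real (2 * max_degree G + k\<^sup>2) \<le> real (n + 1)"
    by (rule of_nat_mono)
  then show ?thesis by simp
qed

end
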